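(* Let $G=(V,E)$ be a simple graph without isolated vertices, regarded as the $2$-uniform hypergraph $E\subseteq 2^V$. Then $G$ is JM if and only if $G$ is connected and minimal transversal-free.
   Context: For a hypergraph $\mathcal H$ on ground set $V$ (nonempty, no empty hyperedge, $V=\bigcup\mathcal H$): the game $NIM_{\mathcal H}$ is played on positions $x\in\mathbb{Z}_{\ge 0}^V$; a move $x\to x'$ chooses $H\in\mathcal H$ and goes to any $x'\in\mathbb Z_{\ge0}^V$ with $x'_i<x_i$ for $i\in H$ and $x'_i=x_i$ for $i\notin H$; players alternate and the player who cannot move loses. The Sprague–Grundy function is $\mathcal G_{\mathcal H}(x)=\mathrm{mex}\{\mathcal G_{\mathcal H}(x') : x\to x' \text{ a move}\}$. The height $h_{\mathcal H}(x)$ is the maximum number of consecutive moves possible from $x$. With $e$ the all-ones vector, $m(x)=\min_{i}x_i$, $y_{\mathcal H}(x)=h_{\mathcal H}(x-m(x)e)+1$, $v_{\mathcal H}(x)=\binom{y_{\mathcal H}(x)}{2}+\big((m(x)-\binom{y_{\mathcal H}(x)}{2}-1)\bmod y_{\mathcal H}(x)\big)$ (residue in $\{0,\dots,y_{\mathcal H}(x)-1\}$), $f_{\mathcal H}(x)=h_{\mathcal H}(x)$ if $m(x)\le\binom{y_{\mathcal H}(x)}{2}$, else $v_{\mathcal H}(x)$. $\mathcal H$ is JM if $\mathcal G_{\mathcal H}=f_{\mathcal H}$. $\mathcal H$ is transversal-free if for each $H\in\mathcal H$ there is a hyperedge disjoint from it; with $\mathcal H_S=\{H\in\mathcal H:H\subseteq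 S\}$, $\mathcal H$ is minimal transversal-free if it is transversal-free and for every $S\subsetneq V$ with $\mathcal H_S\neq\emptyset$ some hyperedge of $\mathcal H_S$ meets all hyperedges of $\mathcal H_S$. For a graph this means: $G$ has no edge meeting all other edges, but for every proper subset $S$ of vertices whose induced subgraph has an edge, that induced subgraph has an edge meeting all its edges. *)

theory Defs
  imports Complex_Main
begin

text \<open>
  A hypergraph is a finite ground set together with a set of nonempty hyperedges that cover it.
\<close>

definition hypergraph :: "'a set \<Rightarrow> 'a set set \<Rightarrow> bool" where
  "hypergraph V \<H> \<longleftrightarrow> finite V \<and> \<H> \<noteq> {} \<and> {} \<notin> \<H> \<and> V = \<Union>\<H>"

text \<open>
  A vector indexed by the ground set is a function on the whole vertex type that vanishes
  outside the ground set.
\<close>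

definition positions :: "'a set \<Rightarrow> ('a \<Rightarrow> nat) set" where
  "positions V = {x. \<forall>i. i \<notin> V \<longrightarrow> x i = 0}"

definition nim_move :: "'a set set \<Rightarrow> ('a \<Rightarrow> nat) \<Rightarrow> ('a \<Rightarrow> nat) \<Rightarrow> bool" where
  "nim_move \<H> x x' \<longleftrightarrow> (\<exists>H\<in>\<H>. (\<forall>i\<in>H. x' i < x i) \<and> (\<forall>i. i \<notin> H \<longrightarrow> x' i = x i))"

definition mex :: "nat set \<Rightarrow> nat" where
  "mex A = (LEAST n. n \<notin> A)"

text \<open>
  The Sprague--Grundy function, by well-founded recursion along moves; the recursion equation
  is lemma \<open>grundy_rec\<close> below.
\<close>

definition grundy :: "'a set set \<Rightarrow> ('a \<Rightarrow> nat) \<Rightarrow> nat" where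
  "grundy \<H> = wfrec {(x', x). nim_move \<H> x x'} (\<lambda>g x. mex (g ` {x'. nim_move \<H> x x'}))"

definition height :: "'a set set \<Rightarrow> ('a \<Rightarrow> nat) \<Rightarrow> nat" where
  "height \<H> x = Max {n. \<exists>x'. (nim_move \<H> ^^ n) x x'}"

definition m_val :: "'a set \<Rightarrow> ('a \<Rightarrow> nat) \<Rightarrow> nat" where
  "m_val V x = Min (x ` V)"

text \<open>
  The subtraction below is exact on the ground set and yields 0 outside it, so that its result
  is again a position.
\<close>

definition y_val :: "'a set \<Rightarrow> 'a set set \<Rightarrow> ('a \<Rightarrow> nat) \<Rightarrow> nat" where
  "y_val V \<H> x = height \<H> (\<lambda>i. x i - m_val V x) + 1"

text \<open>
  The difference is formed in the integers, where \<open>mod\<close> by a positive number gives the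
  nonnegative residue.
\<close>

definition v_val :: "'a set \<Rightarrow> 'a set set \<Rightarrow> ('a \<Rightarrow> nat) \<Rightarrow> nat" where
  "v_val V \<H> x =
     (y_val V \<H> x choose 2) +
     nat ((int (m_val V x) - int (y_val V \<H> x choose 2) - 1) mod int (y_val V \<H> x))"

definition f_val :: "'a set \<Rightarrow> 'a set set \<Rightarrow> ('a \<Rightarrow> nat) \<Rightarrow> nat" where
  "f_val V \<H> x =
     (if m_val V x \<le> (y_val V \<H> x choose 2) then height \<H> x else v_val V \<H> x)"

definition JM :: "'a set \<Rightarrow> 'a set set \<Rightarrow> bool" where
  "JM V \<H> \<longleftrightarrow> (\<forall>x\<in>positions V. grundy \<H> x = f_val V \<H> x)"

definition transversal_free :: "'a set set \<Rightarrow> bool" where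
  "transversal_free \<H> \<longleftrightarrow> (\<forall>H\<in>\<H>. \<exists>H'\<in>\<H>. H \<inter> H' = {})"

definition induced :: "'a set set \<Rightarrow> 'a set \<Rightarrow> 'a set set" where
  "induced \<H> S = {H \<in> \<H>. H \<subseteq> S}"

definition minimal_transversal_free :: "'a set \<Rightarrow> 'a set set \<Rightarrow> bool" where
  "minimal_transversal_free V \<H> \<longleftrightarrow>
     transversal_free \<H> \<and>
     (\<forall>S. S \<subset> V \<and> induced \<H> S \<noteq> {} \<longrightarrow>
        (\<exists>H\<in>induced \<H> S. \<forall>H'\<in>induced \<H> S. H \<inter> H' \<noteq> {}))"

definition simple_graph :: "'a set \<Rightarrow> 'a set set \<Rightarrow> bool" where
  "simple_graph V E \<longleftrightarrow> finite V \<and> V \<noteq> {} \<and> (\<forall>e\<in>E. e \<subseteq> V \<and> card e = 2)"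

definition no_isolated_vertices :: "'a set \<Rightarrow> 'a set set \<Rightarrow> bool" where
  "no_isolated_vertices V E \<longleftrightarrow> (\<forall>v\<in>V. \<exists>e\<in>E. v \<in> e)"

definition graph_connected :: "'a set \<Rightarrow> 'a set set \<Rightarrow> bool" where
  "graph_connected V E \<longleftrightarrow> (\<forall>u\<in>V. \<forall>w\<in>V. (u, w) \<in> {(a, b). {a, b} \<in> E}\<^sup>*)"

lemma simple_graph_hypergraph:
  assumes "simple_graph V E" "no_isolated_vertices V E"
  shows "hypergraph V E"
  using assms unfolding simple_graph_def no_isolated_vertices_def hypergraph_def
  by (auto; fastforce)

lemma nim_move_positions:
  assumes "hypergraph V \<H>" "x \<in> positions V" "nim_move \<H> x x'"
  shows "x' \<in> positions V"
proof -
  from assms(3) obtain H where H: "H \<in> \<H>" "\<forall>i. i \<notin> H \<longrightarrow> x' i = x i"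
    by (auto simp: nim_move_def)
  then have "H \<subseteq> V" using assms(1) by (auto simp: hypergraph_def)
  with H(2) assms(2) show ?thesis by (auto simp: positions_def)
qed

lemma nim_move_sum_less:
  assumes "hypergraph V \<H>" "nim_move \<H> x x'"
  shows "sum x' V < sum x V"
proof -
  from assms(2) obtain H where H: "H \<in> \<H>" "\<forall>i\<in>H. x' i < x i" "\<forall>i. i \<notin> H \<longrightarrow> x' i = x i"
    by (auto simp: nim_move_def)
  from assms(1) H(1) have "finite V" "H \<noteq> {}" "H \<subseteq> V"
    by (auto simp: hypergraph_def)
  then obtain j where "j \<in> H" "j \<in> V" by auto
  with H have "\<exists>i\<in>V. x' i < x i" by auto
  moreover have "x' i \<le> x i" for i using H(2,3) by (cases "i \<in> H") auto
  ultimately show ?thesis using \<open>finite V\<close> by (intro sum_strict_mono_ex1) auto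
qed

lemma wf_nim_move:
  assumes "hypergraph V \<H>"
  shows "wf {(x', x). nim_move \<H> x x'}"
  by (rule wf_subset[OF wf_measure[of "\<lambda>x. sum x V"]])
     (auto dest: nim_move_sum_less[OF assms])

lemma grundy_rec:
  assumes "hypergraph V \<H>"
  shows "grundy \<H> x = mex {grundy \<H> x' | x'. nim_move \<H> x x'}"
proof -
  let ?R = "{(x', x). nim_move \<H> x x'}"
  have "grundy \<H> x = mex (cut (grundy \<H>) ?R x ` {x'. nim_move \<H> x x'})"
    using wfrec[OF wf_nim_move[OF assms]] unfolding grundy_def by blast
  also have "cut (grundy \<H>) ?R x ` {x'. nim_move \<H> x x'}
    = grundy \<H> ` {x'. nim_move \<H> x x'}"
    by (rule image_cong) (auto simp: cut_def)
  also have "\<dots> = {grundy \<H> x' | x'. nim_move \<H> x x'}" by auto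
  finally show ?thesis .
qed

lemma height_set:
  assumes "hypergraph V \<H>"
  shows "finite {n. \<exists>x'. (nim_move \<H> ^^ n) x x'}" "{n. \<exists>x'. (nim_move \<H> ^^ n) x x'} \<noteq> {}"
proof -
  have "n + sum x' V \<le> sum x V" if "(nim_move \<H> ^^ n) x x'" for n x'
    using that
  proof (induction n arbitrary: x')
    case (Suc n)
    then obtain z where "(nim_move \<H> ^^ n) x z" "nim_move \<H> z x'" by auto
    with Suc.IH[of z] nim_move_sum_less[OF assms, of z x'] show ?case by simp
  qed simp
  then have "{n. \<exists>x'. (nim_move \<H> ^^ n) x x'} \<subseteq> {..sum x V}"
    by (auto intro: le_trans[OF le_add1])
  then show "finite {n. \<exists>x'. (nim_move \<H> ^^ n) x x'}" by (rule finite_subset) simp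
  have "(nim_move \<H> ^^ 0) x x" by simp
  then show "{n. \<exists>x'. (nim_move \<H> ^^ n) x x'} \<noteq> {}" by blast
qed

end

theory Submission
  imports Defs
begin

text \<open>
  Heights change by at most one along a chain of moves in which one coordinate is altered by one,
  or in which the end of the chosen edge away from a common vertex is switched. Hence in a
  connected graph (or where one edge meets all edges of the support) the heights reachable
  from \<open>x\<close>, even by moves that empty a vertex, form an interval. Minimality supplies the lower
  end of the interval: an edge meeting all edges that avoid \<open>j\<close> can be emptied, and then every
  edge still playable contains \<open>j\<close>. Removing a constant from all coordinates reduces the
  remaining values to moves that empty a vertex. Transversal-freeness leaves
  \<open>h(x') \<ge> m(x)\<close> after every move \<open>x \<rightarrow> x'\<close>, so no move preserves \<open>f\<close>.

  Conversely, an edge meeting all others gives the all-ones vector a move to a position of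
  value 0 although \<open>f\<close> vanishes there, and the indicator of \<open>S\<close> produces the edge required by minimality.
  A disconnected minimal transversal-free graph consists of two disjoint edges, and there
  the position with entries 3, 3, 1, 1 has no move to value 2.
\<close>

section \<open>The height as a packing number\<close>

text \<open>An integral matching with capacities \<open>x\<close>, kept as a list because a
  hyperedge may be used repeatedly. A chain of moves lists its hyperedges; conversely a packing is
  played by lowering entries by exactly one. So the height is the maximal length of a
  packing.\<close>

definition packing :: "'a set set \<Rightarrow> ('a \<Rightarrow> nat) \<Rightarrow> 'a set list \<Rightarrow> bool" where
  "packing \<H> x es \<longleftrightarrow> set es \<subseteq> \<H> \<and> (\<forall>i. length (filter (\<lambda>e. i \<in> e) es) \<le> x i)"

lemma packing_of_moves:
  "(nim_move \<H> ^^ n) x x' \<Longrightarrow> \<exists>es. packing \<H> x es \<and> length es = n"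
proof (induction n arbitrary: x)
  case 0
  show ?case by (intro exI[of _ "[]"]) (simp add: packing_def)
next
  case (Suc n)
  from relpowp_Suc_D2[OF Suc.prems] obtain z where z: "nim_move \<H> x z" "(nim_move \<H> ^^ n) z x'"
    by blast
  from Suc.IH[OF z(2)] obtain es where es: "packing \<H> z es" "length es = n" by blast
  from z(1) obtain H where H: "H \<in> \<H>" "\<forall>i\<in>H. z i < x i" "\<forall>i. i \<notin> H \<longrightarrow> z i = x i"
    by (auto simp: nim_move_def)
  have "length (filter (\<lambda>e. i \<in> e) (H # es)) \<le> x i" for i
  proof -
    have "length (filter (\<lambda>e. i \<in> e) es) \<le> z i" using es(1) by (simp add: packing_def)
    moreover have "z i < x i" if "i \<in> H" using H(2) that by blast
    moreover have "z i = x i" if "i \<notin> H" using H(3) that by blast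
    ultimately show ?thesis by (cases "i \<in> H") simp_all
  qed
  then have "packing \<H> x (H # es)" using H(1) es(1) by (simp add: packing_def)
  with es(2) show ?case by (intro exI[of _ "H # es"]) simp
qed

lemma moves_of_packing:
  "packing \<H> x es \<Longrightarrow> \<exists>x'. (nim_move \<H> ^^ length es) x x'"
proof (induction es arbitrary: x)
  case Nil
  show ?case by simp
next
  case (Cons e es)
  define z where "z i = (if i \<in> e then x i - 1 else x i)" for i
  have c: "length (filter (\<lambda>e. i \<in> e) (e # es)) \<le> x i" for i
    using Cons.prems unfolding packing_def by blast
  have pos: "0 < x i" if "i \<in> e" for i
    using c[of i] that by simp
  have "length (filter (\<lambda>e. i \<in> e) es) \<le> z i" for i
    using c[of i] by (cases "i \<in> e") (simp_all add: z_def)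
  then have "packing \<H> z es" using Cons.prems by (simp add: packing_def)
  then obtain x' where x': "(nim_move \<H> ^^ length es) z x'" using Cons.IH by blast
  have "nim_move \<H> x z"
    unfolding nim_move_def using Cons.prems pos by (intro bexI[of _ e]) (auto simp: z_def packing_def)
  then show ?case using x' by (metis length_Cons relpowp_Suc_I2)
qed

lemma packing_remove1:
  assumes "packing \<H> x es" "e \<in> set es"
    "\<And>i. (if i \<in> e then x i - 1 else x i) \<le> x' i"
  shows "packing \<H> x' (remove1 e es)"
proof -
  have "length (filter (\<lambda>e. i \<in> e) (remove1 e es)) \<le> x' i" for i
  proof -
    have "length (filter (\<lambda>e. i \<in> e) es) \<le> x i" using assms(1) by (simp add: packing_def)
    then show ?thesis using assms(2) assms(3)[of i]
      by (cases "i \<in> e") (auto simp: filter_remove1 length_remove1)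
  qed
  moreover have "set (remove1 e es) \<subseteq> \<H>"
    using assms(1) set_remove1_subset[of e es] by (auto simp: packing_def)
  ultimately show ?thesis by (simp add: packing_def)
qed

lemma packing_pos:
  assumes "packing \<H> x es" "e \<in> set es" "i \<in> e"
  shows "0 < x i"
proof -
  have "filter (\<lambda>e. i \<in> e) es \<noteq> []" using assms(2,3) by (auto simp: filter_empty_conv)
  moreover have "length (filter (\<lambda>e. i \<in> e) es) \<le> x i" using assms(1) by (simp add: packing_def)
  ultimately show ?thesis by (metis length_greater_0_conv less_le_trans)
qed

locale nim_hypergraph =
  fixes V :: "'a set" and E :: "'a set set"
  assumes hyp: "hypergraph V E"
begin

lemma fin: "finite V" and V_nonempty: "V \<noteq> {}"
  and edge_sub: "e \<in> E \<Longrightarrow> e \<subseteq> V" and edge_nonempty: "e \<in> E \<Longrightarrow> e \<noteq> {}"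
  and covered: "i \<in> V \<Longrightarrow> \<exists>e\<in>E. i \<in> e"
  using hyp unfolding hypergraph_def by auto

lemma length_packing_le: "packing E x es \<Longrightarrow> length es \<le> height E x"
  unfolding height_def using height_set[OF hyp] moves_of_packing by (intro Max_ge) auto

lemma height_packing: "\<exists>es. packing E x es \<and> length es = height E x"
proof -
  have "height E x \<in> {n. \<exists>x'. (nim_move E ^^ n) x x'}"
    unfolding height_def using height_set[OF hyp] by (rule Max_in)
  then show ?thesis using packing_of_moves by blast
qed

lemma height_mono:
  assumes "\<And>i. x i \<le> x' i"
  shows "height E x \<le> height E x'"
proof -
  from height_packing obtain es where es: "packing E x es" "length es = height E x" by blast
  then have "packing E x' es" using assms unfolding packing_def by (meson le_trans)
  then show ?thesis using length_packing_le es(2) by metis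
qed

text \<open>If an optimal packing uses \<open>u\<close>, discarding one of its edges through
  \<open>u\<close> makes up for the missing unit; otherwise the capacity at \<open>u\<close> does
  not matter.\<close>

lemma height_unit:
  assumes "\<And>i. i \<noteq> u \<Longrightarrow> x i \<le> x' i" "x u \<le> Suc (x' u)"
  shows "height E x \<le> Suc (height E x')"
proof -
  from height_packing obtain es where es: "packing E x es" "length es = height E x" by blast
  show ?thesis
  proof (cases "\<exists>e\<in>set es. u \<in> e")
    case True
    then obtain e where e: "e \<in> set es" "u \<in> e" by blast
    have "(if i \<in> e then x i - 1 else x i) \<le> x' i" for i
      using assms(1)[of i] assms(2) e(2) by (cases "i = u") auto
    with es(1) e(1) have "packing E x' (remove1 e es)" by (rule packing_remove1)
    from length_packing_le[OF this] show ?thesis using e(1) es(2) by (simp add: length_remove1)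
  next
    case False
    have "length (filter (\<lambda>e. i \<in> e) es) \<le> x' i" for i
    proof (cases "i = u")
      case True
      with False have "filter (\<lambda>e. i \<in> e) es = []" by (auto simp: filter_empty_conv)
      then show ?thesis by simp
    next
      case False
      then show ?thesis using es(1) assms(1)[of i] unfolding packing_def by (meson le_trans)
    qed
    then have "packing E x' es" using es(1) by (simp add: packing_def)
    from length_packing_le[OF this] show ?thesis using es(2) by simp
  qed
qed

lemma height_ge_edge:
  assumes "e \<in> E" "\<And>i. i \<in> e \<Longrightarrow> n \<le> x i"
  shows "n \<le> height E x"
proof -
  have "packing E x (replicate n e)"
    using assms by (auto simp: packing_def filter_replicate)
  from length_packing_le[OF this] show ?thesis by simp
qed

text \<open>Every member of a packing passes through \<open>j\<close>, so the length of the packing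
  is the load at \<open>j\<close>.\<close>

lemma height_le_vertex:
  assumes "\<And>e. e \<in> E \<Longrightarrow> (\<And>i. i \<in> e \<Longrightarrow> 0 < x i) \<Longrightarrow> j \<in> e"
  shows "height E x \<le> x j"
proof -
  from height_packing obtain es where es: "packing E x es" "length es = height E x" by blast
  have "j \<in> e" if "e \<in> set es" for e
    using assms[of e] packing_pos[OF es(1) that] es(1) that by (auto simp: packing_def)
  then have "filter (\<lambda>e. j \<in> e) es = es" by simp
  then show ?thesis using es unfolding packing_def by metis
qed

lemma height_eq_0:
  assumes "\<And>e. e \<in> E \<Longrightarrow> \<exists>i\<in>e. x i = 0"
  shows "height E x = 0"
proof (rule ccontr)
  assume "height E x \<noteq> 0"
  moreover from height_packing obtain es where es: "packing E x es" "length es = height E x" by blast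
  ultimately obtain e where e: "e \<in> set es" by (cases es) auto
  then have "e \<in> E" using es(1) by (auto simp: packing_def)
  from assms[OF this] packing_pos[OF es(1) e] show False by force
qed

lemma height_move_less:
  assumes "nim_move E x x'"
  shows "height E x' < height E x"
proof -
  from height_packing moves_of_packing obtain z where "(nim_move E ^^ height E x') x' z" by metis
  with assms have "(nim_move E ^^ Suc (height E x')) x z" by (rule relpowp_Suc_I2)
  from packing_of_moves[OF this] show ?thesis using length_packing_le by (metis Suc_le_eq)
qed

section \<open>Intermediate heights\<close>

text \<open>Both ends lie in \<open>M\<close>, so paths never leave \<open>M\<close>; its closure
  acts as path connectedness in a discrete intermediate value theorem for the height.\<close>

definition link :: "('a \<Rightarrow> nat) set \<Rightarrow> (('a \<Rightarrow> nat) \<times> ('a \<Rightarrow> nat)) set" where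
  "link M = {(p, q). p \<in> M \<and> q \<in> M \<and> height E p \<le> Suc (height E q) \<and> height E q \<le> Suc (height E p)}"

lemma link_sym: "(p, q) \<in> (link M)\<^sup>* \<Longrightarrow> (q, p) \<in> (link M)\<^sup>*"
proof -
  have "sym (link M)" by (auto simp: sym_def link_def)
  then show "(p, q) \<in> (link M)\<^sup>* \<Longrightarrow> (q, p) \<in> (link M)\<^sup>*" by (metis sym_rtrancl symD)
qed

lemma link_mono: "M \<subseteq> N \<Longrightarrow> (p, q) \<in> (link M)\<^sup>* \<Longrightarrow> (p, q) \<in> (link N)\<^sup>*"
  by (rule subsetD[OF rtrancl_mono]) (auto simp: link_def)

lemma link_intermediate:
  assumes "(p, q) \<in> (link M)\<^sup>*" "p \<in> M" "height E q \<le> v" "v \<le> height E p"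
  shows "\<exists>r\<in>M. height E r = v"
  using assms(1,3)
proof (induction rule: rtrancl_induct)
  case base
  then show ?case using assms(2,4) by force
next
  case (step q q')
  show ?case
  proof (cases "height E q \<le> v")
    case True
    then show ?thesis by (rule step.IH)
  next
    case False
    \<comment> \<open>\<open>q\<close> is still above \<open>v\<close> and \<open>q'\<close> is not;
      as they differ by at most one, \<open>q'\<close> hits \<open>v\<close>.\<close>
    with step.hyps step.prems have "height E q' = v" "q' \<in> M" by (auto simp: link_def)
    then show ?thesis by blast
  qed
qed

text \<open>A zero entry makes the minimum 0, where \<open>f_val\<close> is the height, so only
  heights need to be controlled along these moves.\<close>

definition zero_moves :: "('a \<Rightarrow> nat) \<Rightarrow> ('a \<Rightarrow> nat) set" where
  "zero_moves x = {x'. nim_move E x x' \<and> (\<exists>i\<in>V. x' i = 0)}"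

text \<open>The hub of the chains below: in a graph, every move along \<open>e\<close> that empties
  a vertex can be continued to it one unit at a time.\<close>

definition center :: "'a set \<Rightarrow> ('a \<Rightarrow> nat) \<Rightarrow> 'a \<Rightarrow> nat" where
  "center e x = (\<lambda>i. if i \<in> e then 0 else x i)"

lemma link_descend:
  assumes "\<And>a. a < n \<Longrightarrow> x(u := a) \<in> M" "b < n"
  shows "(x(u := b), x(u := 0)) \<in> (link M)\<^sup>*"
  using assms(2)
proof (induction b)
  case (Suc b)
  have "(x(u := Suc b), x(u := b)) \<in> link M"
    using assms(1)[of "Suc b"] assms(1)[of b] Suc.prems
      height_unit[of u "x(u := Suc b)" "x(u := b)"] height_mono[of "x(u := b)" "x(u := Suc b)"]
    by (auto simp: link_def intro: le_SucI)
  also have "(x(u := b), x(u := 0)) \<in> (link M)\<^sup>*" by (rule Suc.IH[OF Suc_lessD[OF Suc.prems]])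
  finally show ?case .
qed simp

end

section \<open>Chains of moves in a graph\<close>

locale nim_graph = nim_hypergraph +
  assumes card2: "e \<in> E \<Longrightarrow> card e = 2"
begin

lemma other_end:
  assumes "e \<in> E" "u \<in> e"
  obtains v where "e = {u, v}" "u \<noteq> v"
  using card2[OF assms(1)] assms(2) by (auto simp: card_2_iff)

lemma edge_move:
  assumes "{u, v} \<in> E" "u \<noteq> v" "a < x u" "b < x v"
  shows "nim_move E x (x(u := a, v := b))"
  unfolding nim_move_def using assms by (intro bexI[of _ "{u, v}"]) auto

lemma edge_zero_move:
  assumes "{u, v} \<in> E" "u \<noteq> v" "0 < x u" "b < x v"
  shows "x(u := 0, v := b) \<in> zero_moves x"
  using edge_move[of u v 0 x b] assms edge_sub[of "{u, v}"]
  by (auto simp: zero_moves_def intro!: bexI[of _ u])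

lemma link_center:
  assumes "{u, v} \<in> E" "u \<noteq> v" "0 < x u" "b < x v"
  shows "(x(u := 0, v := b), center {u, v} x) \<in> (link (zero_moves x))\<^sup>*"
proof -
  have "center {u, v} x = x(u := 0, v := 0)" by (auto simp: center_def)
  moreover have "(x(u := 0, v := b), x(u := 0, v := 0)) \<in> (link (zero_moves x))\<^sup>*"
    using assms by (intro link_descend[where n = "x v"] edge_zero_move)
  ultimately show ?thesis by simp
qed

text \<open>\<open>?p\<close> and \<open>?q\<close> each take one further unit from
  \<open>?y\<close>, so each has the height of \<open>?y\<close> or one less. This switches edges
  while the shared vertex stays empty.\<close>

lemma link_centers_adjacent:
  assumes "e \<in> E" "f \<in> E" "u \<in> e" "u \<in> f" "\<And>i. i \<in> e \<union> f \<Longrightarrow> 0 < x i"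
  shows "(center e x, center f x) \<in> (link (zero_moves x))\<^sup>*"
proof -
  from other_end[OF assms(1,3)] obtain v where v: "e = {u, v}" "u \<noteq> v" by blast
  from other_end[OF assms(2,4)] obtain w where w: "f = {u, w}" "u \<noteq> w" by blast
  let ?y = "x(u := 0)"
  let ?p = "x(u := 0, v := x v - 1)" and ?q = "x(u := 0, w := x w - 1)"
  have pos: "0 < x u" "0 < x v" "0 < x w" using assms(5) v w by auto
  have "(?p, center e x) \<in> (link (zero_moves x))\<^sup>*" "(?q, center f x) \<in> (link (zero_moves x))\<^sup>*"
    using link_center[of u v x "x v - 1"] link_center[of u w x "x w - 1"] assms(1,2) v w pos by auto
  moreover have "(?p, ?q) \<in> link (zero_moves x)"
  proof -
    have "height E ?p \<le> height E ?y" "height E ?q \<le> height E ?y"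
      using v(2) w(2) by (auto intro!: height_mono)
    moreover have "height E ?y \<le> Suc (height E ?p)"
      using v(2) by (intro height_unit[of v]) auto
    moreover have "height E ?y \<le> Suc (height E ?q)"
      using w(2) by (intro height_unit[of w]) auto
    moreover have "?p \<in> zero_moves x" "?q \<in> zero_moves x"
      using edge_zero_move[of u v x "x v - 1"] edge_zero_move[of u w x "x w - 1"] assms(1,2) v w pos by auto
    ultimately show ?thesis by (simp add: link_def)
  qed
  ultimately show ?thesis by (meson link_sym r_into_rtrancl rtrancl_trans)
qed

lemma link_centers_connected:
  assumes "graph_connected V E" "e \<in> E" "f \<in> E" "\<And>i. i \<in> V \<Longrightarrow> 0 < x i"
  shows "(center e x, center f x) \<in> (link (zero_moves x))\<^sup>*"
proof -
  obtain u w where uw: "u \<in> e" "w \<in> f" using edge_nonempty assms(2,3) by blast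
  then have "(u, w) \<in> {(a, b). {a, b} \<in> E}\<^sup>*"
    using assms(1-3) edge_sub unfolding graph_connected_def by blast
  then have "\<forall>f\<in>E. w \<in> f \<longrightarrow> (center e x, center f x) \<in> (link (zero_moves x))\<^sup>*"
  proof (induction rule: rtrancl_induct)
    case base
    show ?case
    proof (intro ballI impI)
      fix f assume "f \<in> E" "u \<in> f"
      then show "(center e x, center f x) \<in> (link (zero_moves x))\<^sup>*"
        using assms(2,4) uw(1) edge_sub by (intro link_centers_adjacent[of e f u]) auto
    qed
  next
    case (step w w')
    then have ww: "{w, w'} \<in> E" by simp
    show ?case
    proof (intro ballI impI)
      fix f assume f: "f \<in> E" "w' \<in> f"
      have "(center e x, center {w, w'} x) \<in> (link (zero_moves x))\<^sup>*" using step.IH ww by blast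
      also have "(center {w, w'} x, center f x) \<in> (link (zero_moves x))\<^sup>*"
        using f ww assms(4) edge_sub by (intro link_centers_adjacent[of _ _ w']) auto
      finally show "(center e x, center f x) \<in> (link (zero_moves x))\<^sup>*" .
    qed
  qed
  then show ?thesis using assms(3) uw(2) by blast
qed

text \<open>First \<open>u\<close> is lowered to 0, then \<open>v\<close>. Positions of the first
  stage may have no zero entry, hence the separate assumption placing them in
  \<open>M\<close>.\<close>

lemma link_to_center:
  assumes "{u, v} \<in> E" "u \<noteq> v" "0 < x u" "0 < x v"
    "zero_moves x \<subseteq> M" "\<And>a. a < x u \<Longrightarrow> x(u := a, v := x v - 1) \<in> M"
  shows "(x(u := x u - 1, v := x v - 1), center {u, v} x) \<in> (link M)\<^sup>*"
proof -
  have *: "x(u := a, v := x v - 1) = (x(v := x v - 1))(u := a)" for a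
    using assms(2) by (rule fun_upd_twist)
  have "(x(u := x u - 1, v := x v - 1), x(u := 0, v := x v - 1)) \<in> (link M)\<^sup>*"
    unfolding * using assms(3) by (intro link_descend[where n = "x u"] assms(6)[unfolded *]) simp_all
  also have "(x(u := 0, v := x v - 1), center {u, v} x) \<in> (link M)\<^sup>*"
    using assms(1-5) by (intro link_mono[OF assms(5)] link_center) auto
  finally show ?thesis .
qed

lemma height_remove_edge:
  assumes "packing E x es" "length es = height E x" "{u, v} \<in> set es" "u \<noteq> v"
  shows "height E x \<le> Suc (height E (x(u := x u - 1, v := x v - 1)))"
proof -
  have "packing E (x(u := x u - 1, v := x v - 1)) (remove1 {u, v} es)"
    using assms(4) by (intro packing_remove1[OF assms(1,3)]) auto
  from length_packing_le[OF this] show ?thesis using assms(2,3) by (simp add: length_remove1)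
qed

text \<open>An edge of an optimal packing through \<open>j\<close> costs one unit of height. If
  there is none, lowering \<open>j\<close> is free and the other end of any edge at \<open>j\<close>
  costs at most one.\<close>

lemma optimal_edge_at:
  assumes "j \<in> V"
  shows "\<exists>k. {j, k} \<in> E \<and> j \<noteq> k \<and> height E x \<le> Suc (height E (x(j := x j - 1, k := x k - 1)))"
proof -
  from height_packing obtain es where es: "packing E x es" "length es = height E x" by blast
  show ?thesis
  proof (cases "\<exists>e\<in>set es. j \<in> e")
    case True
    then obtain e where e: "e \<in> set es" "j \<in> e" by blast
    then have "e \<in> E" using es(1) by (auto simp: packing_def)
    with e(2) obtain k where "e = {j, k}" "j \<noteq> k" using other_end by blast
    then show ?thesis using height_remove_edge[of x es j k] es e(1) \<open>e \<in> E\<close> by blast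
  next
    case False
    from covered[OF assms] obtain e where e: "e \<in> E" "j \<in> e" by blast
    then obtain k where k: "e = {j, k}" "j \<noteq> k" using other_end by blast
    have "length (filter (\<lambda>e. i \<in> e) es) \<le> (x(j := x j - 1)) i" for i
    proof (cases "i = j")
      case True
      with False have "filter (\<lambda>e. i \<in> e) es = []" by (auto simp: filter_empty_conv)
      then show ?thesis by simp
    qed (use es(1) in \<open>simp add: packing_def\<close>)
    then have "packing E (x(j := x j - 1)) es" using es(1) by (simp add: packing_def)
    from length_packing_le[OF this] es(2) have "height E x \<le> height E (x(j := x j - 1))" by simp
    also have "\<dots> \<le> Suc (height E (x(j := x j - 1, k := x k - 1)))"
      using k(2) by (intro height_unit[of k]) auto
    finally show ?thesis using e k by blast
  qed
qed

text \<open>Lowering both ends of an edge of an optimal packing by one loses at most one unit of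
  height. That edge meets \<open>d\<close>, so a chain leads on to the emptying of \<open>d\<close>,
  after which nothing can be played.\<close>

lemma all_lower_heights:
  assumes "d \<in> E" "\<And>i. i \<in> d \<Longrightarrow> 0 < x i"
    "\<And>f. f \<in> E \<Longrightarrow> (\<And>i. i \<in> f \<Longrightarrow> 0 < x i) \<Longrightarrow> d \<inter> f \<noteq> {}"
    and v: "v < height E x"
  shows "\<exists>x'. nim_move E x x' \<and> height E x' = v"
proof -
  let ?M = "{x'. nim_move E x x'}"
  from height_packing obtain es where es: "packing E x es" "length es = height E x" by blast
  with v obtain e where e: "e \<in> set es" by (cases es) auto
  then have eE: "e \<in> E" using es(1) by (auto simp: packing_def)
  have epos: "0 < x i" if "i \<in> e" for i using packing_pos[OF es(1) e that] .
  then obtain w where w: "w \<in> d" "w \<in> e" using assms(3)[OF eE] by blast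
  obtain u where u: "e = {w, u}" "w \<noteq> u" using other_end[OF eE w(2)] by blast
  let ?p = "x(w := x w - 1, u := x u - 1)"
  have "height E x \<le> Suc (height E ?p)" using height_remove_edge[of x es w u] es e u by blast
  then have vp: "v \<le> height E ?p" using v by simp
  have pM: "?p \<in> ?M" using edge_move[of w u "x w - 1" x "x u - 1"] eE u epos by auto
  have zM: "zero_moves x \<subseteq> ?M" by (auto simp: zero_moves_def)
  have "(?p, center {w, u} x) \<in> (link ?M)\<^sup>*"
    using eE u epos by (intro link_to_center) (auto simp: zero_moves_def intro!: edge_move)
  also have "(center {w, u} x, center d x) \<in> (link ?M)\<^sup>*"
    using eE u epos w assms(1,2) by (intro link_mono[OF zM] link_centers_adjacent[of _ _ w]) auto
  finally have "(?p, center d x) \<in> (link ?M)\<^sup>*" .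
  moreover have "height E (center d x) = 0"
  proof (rule height_eq_0)
    fix g assume g: "g \<in> E"
    show "\<exists>i\<in>g. center d x i = 0"
    proof (rule ccontr)
      assume "\<not> ?thesis"
      then have "i \<notin> d \<and> 0 < x i" if "i \<in> g" for i
        using that by (auto simp: center_def split: if_splits)
      then show False using assms(3)[OF g] by blast
    qed
  qed
  ultimately show ?thesis using link_intermediate[of ?p "center d x" ?M v] pM vp by auto
qed

end

section \<open>The formula of Jenkyns and Mayberry\<close>

lemma choose_two_Suc: "Suc n choose 2 = (n choose 2) + n"
  by (simp add: numeral_2_eq_2)

lemma less_of_choose_two: "p choose 2 < n choose 2 \<Longrightarrow> p < n"
  by (metis binomial_right_mono linorder_not_le)

text \<open>This is the shape of \<open>v_val\<close>, with \<open>p\<close> as the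
  \<open>y_val\<close> and \<open>r\<close> as the residue; it tells which position to aim
  for.\<close>

lemma triangular_decomp: "\<exists>p r. r < p \<and> v = (p choose 2) + r"
proof (induction v)
  case 0
  show ?case by (intro exI[of _ 1] exI[of _ 0]) simp
next
  case (Suc v)
  then obtain p r where pr: "r < p" "v = (p choose 2) + r" by blast
  show ?case
  proof (cases "Suc r < p")
    case True
    then show ?thesis using pr by (intro exI[of _ p] exI[of _ "Suc r"]) simp
  next
    case False
    then show ?thesis using pr choose_two_Suc[of p]
      by (intro exI[of _ "Suc p"] exI[of _ 0]) simp
  qed
qed

context nim_hypergraph
begin

lemma m_val_le: "i \<in> V \<Longrightarrow> m_val V x \<le> x i"
  unfolding m_val_def using fin by (intro Min_le) auto

lemma m_val_attained: "\<exists>j\<in>V. x j = m_val V x"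
proof -
  have "Min (x ` V) \<in> x ` V" using fin V_nonempty by (intro Min_in) auto
  then show ?thesis unfolding m_val_def by auto
qed

lemma m_val_eqI: "j \<in> V \<Longrightarrow> x j = a \<Longrightarrow> (\<And>i. i \<in> V \<Longrightarrow> a \<le> x i) \<Longrightarrow> m_val V x = a"
  unfolding m_val_def using fin by (intro Min_eqI) auto

lemma f_val_of_zero: "i \<in> V \<Longrightarrow> x i = 0 \<Longrightarrow> f_val V E x = height E x"
  using m_val_eqI[of i x 0] by (simp add: f_val_def)

text \<open>The summand 1 cancels the -1 in \<open>v_val\<close>, leaving residue \<open>r\<close>,
  and lifts the minimum above the binomial coefficient, into the second branch.\<close>

lemma f_val_eq_v:
  assumes "y_val V E x = p" "r < p" "m_val V x = (p choose 2) + r + 1 + p * q"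
  shows "f_val V E x = (p choose 2) + r"
proof -
  have "int (m_val V x) - int (p choose 2) - 1 = int (r + p * q)" using assms(3) by simp
  then have "(int (m_val V x) - int (p choose 2) - 1) mod int p = int r"
    using assms(2) by (metis mod_less mod_mult_self2 of_nat_mod)
  then show ?thesis using assms by (simp add: f_val_def v_val_def)
qed

lemma v_decomp:
  assumes "\<not> m_val V x \<le> (y_val V E x choose 2)"
  obtains r q where "r < y_val V E x" "f_val V E x = (y_val V E x choose 2) + r"
    "m_val V x = (y_val V E x choose 2) + r + 1 + y_val V E x * q"
proof -
  let ?y = "y_val V E x"
  define k where "k = m_val V x - (?y choose 2) - 1"
  have r: "k mod ?y < ?y" by (simp add: y_val_def)
  have m: "m_val V x = (?y choose 2) + k mod ?y + 1 + ?y * (k div ?y)"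
    using assms by (simp add: k_def add.commute add.left_commute)
  show thesis using that[OF r f_val_eq_v[OF refl r m] m] .
qed

text \<open>Used to separate the branches: heights after a move from \<open>x\<close> are at least
  \<open>m_val V x\<close>.\<close>

lemma f_val_less_m_val:
  assumes "\<not> m_val V x \<le> (y_val V E x choose 2)"
  shows "f_val V E x < m_val V x"
  by (rule v_decomp[OF assms]) simp

lemma y_val_eq: "m_val V x = a \<Longrightarrow> y_val V E x = Suc (height E (\<lambda>i. x i - a))"
  by (simp add: y_val_def)

end

section \<open>Sufficiency: connected minimal transversal-free graphs\<close>

locale nim_graph_mtf = nim_graph +
  assumes connected: "graph_connected V E"
    and mtf: "minimal_transversal_free V E"
begin

lemma disjoint_edge: "e \<in> E \<Longrightarrow> \<exists>f\<in>E. e \<inter> f = {}"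
  using mtf by (auto simp: minimal_transversal_free_def transversal_free_def)

lemma dominating_edge:
  assumes "S \<subset> V" "f \<in> E" "f \<subseteq> S"
  shows "\<exists>d\<in>E. d \<subseteq> S \<and> (\<forall>g\<in>E. g \<subseteq> S \<longrightarrow> d \<inter> g \<noteq> {})"
proof -
  have "induced E S \<noteq> {}" using assms(2,3) by (auto simp: induced_def)
  then have "\<exists>d\<in>induced E S. \<forall>g\<in>induced E S. d \<inter> g \<noteq> {}"
    using mtf assms(1) unfolding minimal_transversal_free_def by simp
  then obtain d where "d \<in> induced E S" "\<forall>g\<in>induced E S. d \<inter> g \<noteq> {}" by blast
  then show ?thesis by (intro bexI[of _ d]) (simp_all add: induced_def)
qed

text \<open>Some edge avoids \<open>j\<close>, so minimality applies to \<open>V - {j}\<close> and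
  yields \<open>d\<close> meeting every edge that avoids \<open>j\<close>. Once \<open>d\<close> is
  emptied, all playable edges contain \<open>j\<close>.\<close>

lemma small_center:
  assumes "j \<in> V"
  shows "\<exists>d\<in>E. height E (center d x) \<le> x j"
proof -
  from covered[OF assms] obtain e where e: "e \<in> E" "j \<in> e" by blast
  then obtain f where "f \<in> E" "e \<inter> f = {}" using disjoint_edge by blast
  then have f: "f \<in> E" "f \<subseteq> V - {j}" using e(2) edge_sub by auto
  have "V - {j} \<subset> V" using assms by blast
  from dominating_edge[OF this f] obtain d where d: "d \<in> E"
    "\<forall>g\<in>E. g \<subseteq> V - {j} \<longrightarrow> d \<inter> g \<noteq> {}" by blast
  have "height E (center d x) \<le> center d x j"
  proof (rule height_le_vertex)
    fix g assume g: "g \<in> E" "\<And>i. i \<in> g \<Longrightarrow> 0 < center d x i"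
    then have "d \<inter> g = {}" by (force simp: center_def)
    with d(2) g(1) edge_sub[OF g(1)] show "j \<in> g" by blast
  qed
  also have "\<dots> \<le> x j" by (simp add: center_def)
  finally show ?thesis using d(1) by blast
qed

text \<open>Here \<open>s\<close> is the minimum. A chain of zero moves runs from \<open>?p\<close>
  to the center of \<open>small_center\<close>, whose height is at most \<open>s\<close>.\<close>

lemma zero_move_height:
  assumes "\<And>i. i \<in> V \<Longrightarrow> s \<le> x i" "0 < s" "j \<in> V" "x j = s"
    and v: "s \<le> v" "v \<le> height E (\<lambda>i. x i - s)"
  shows "\<exists>x'\<in>zero_moves x. height E x' = v"
proof -
  from covered[OF assms(3)] obtain e where e: "e \<in> E" "j \<in> e" by blast
  then obtain k where k: "e = {j, k}" "j \<noteq> k" using other_end by blast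
  have kV: "k \<in> V" using edge_sub[OF e(1)] k by auto
  have pos: "0 < x i" if "i \<in> V" for i using assms(1)[OF that] assms(2) by simp
  let ?p = "x(j := 0, k := x k - 1)"
  from small_center[OF assms(3)] obtain d where d: "d \<in> E" "height E (center d x) \<le> x j" by blast
  have "(?p, center {j, k} x) \<in> (link (zero_moves x))\<^sup>*"
    using e(1) k pos[OF kV] pos[OF assms(3)] by (intro link_center) auto
  also have "(center {j, k} x, center d x) \<in> (link (zero_moves x))\<^sup>*"
    using e(1) k(1) d(1) pos by (intro link_centers_connected[OF connected]) auto
  finally have "(?p, center d x) \<in> (link (zero_moves x))\<^sup>*" .
  \<comment> \<open>At \<open>j\<close> both entries are 0; at \<open>k\<close> the move takes 1,
    which is at most \<open>s\<close>.\<close>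
  moreover have "height E (\<lambda>i. x i - s) \<le> height E ?p"
    using assms(2,4) by (intro height_mono) auto
  moreover have "?p \<in> zero_moves x"
    using e(1) k pos[OF kV] pos[OF assms(3)] by (intro edge_zero_move) auto
  ultimately show ?thesis
    using d(2) v assms(4) by (intro link_intermediate[of ?p "center d x"]) auto
qed

text \<open>The support misses \<open>j\<close>, so minimality gives an edge in it that meets all
  playable edges.\<close>

lemma lower_heights_of_zero:
  assumes "j \<in> V" "x j = 0" "v < height E x"
  shows "\<exists>x'. nim_move E x x' \<and> height E x' = v"
proof -
  let ?S = "{i \<in> V. 0 < x i}"
  have "j \<notin> ?S" using assms(2) by simp
  then have "?S \<subset> V" using assms(1) by blast
  from assms(3) height_eq_0[of x] obtain f where "f \<in> E" "\<forall>i\<in>f. x i \<noteq> 0" by fastforce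
  then have f: "f \<in> E" "f \<subseteq> ?S" using edge_sub by auto
  from dominating_edge[OF \<open>?S \<subset> V\<close> f] obtain d
    where d: "d \<in> E" "d \<subseteq> ?S" "\<forall>g\<in>E. g \<subseteq> ?S \<longrightarrow> d \<inter> g \<noteq> {}" by blast
  show ?thesis
  proof (rule all_lower_heights[OF d(1) _ _ assms(3)])
    show "0 < x i" if "i \<in> d" for i using d(2) that by blast
    show "d \<inter> g \<noteq> {}" if "g \<in> E" "\<And>i. i \<in> g \<Longrightarrow> 0 < x i" for g
      using d(3) that edge_sub[OF that(1)] by blast
  qed
qed

text \<open>An edge disjoint from the one just played keeps its entries and can still be played
  \<open>m_val V x\<close> times.\<close>

lemma height_ge_m_val:
  assumes "nim_move E x x'"
  shows "m_val V x \<le> height E x'"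
proof -
  from assms obtain H where H: "H \<in> E" "\<forall>i. i \<notin> H \<longrightarrow> x' i = x i" by (auto simp: nim_move_def)
  from disjoint_edge[OF H(1)] obtain f where f: "f \<in> E" "H \<inter> f = {}" by blast
  show ?thesis
  proof (rule height_ge_edge[OF f(1)])
    fix i assume "i \<in> f"
    then have "x' i = x i" "i \<in> V" using H(2) f edge_sub by auto
    then show "m_val V x \<le> x' i" using m_val_le by simp
  qed
qed

lemma f_val_move_neq:
  assumes "nim_move E x x'"
  shows "f_val V E x \<noteq> f_val V E x'"
proof
  assume eq: "f_val V E x = f_val V E x'"
  from assms obtain H where H: "H \<in> E" "\<forall>i\<in>H. x' i < x i" "\<forall>i. i \<notin> H \<longrightarrow> x' i = x i"
    by (auto simp: nim_move_def)
  have le: "x' i \<le> x i" for i using H(2,3) by (cases "i \<in> H") auto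
  from m_val_attained obtain j where j: "j \<in> V" "x j = m_val V x" by blast
  then have mle: "m_val V x' \<le> m_val V x" using m_val_le[of j x'] le[of j] by simp
  note hle = height_ge_m_val[OF assms] and hless = height_move_less[OF assms]
  let ?I = "m_val V x \<le> (y_val V E x choose 2)" and ?I' = "m_val V x' \<le> (y_val V E x' choose 2)"
  consider "?I" "?I'" | "?I" "\<not> ?I'" | "\<not> ?I" "?I'" | "\<not> ?I" "\<not> ?I'" by blast
  then show False
  proof cases
    case 1
    then show ?thesis using eq hless by (simp add: f_val_def)
  next
    case 2
    \<comment> \<open>The chain is f(x') < m(x') <= m(x) <= h(x') < h(x) = f(x).\<close>
    show ?thesis using f_val_less_m_val[OF 2(2)] 2(1) eq hle hless mle by (simp add: f_val_def)
  next
    case 3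
    show ?thesis using f_val_less_m_val[OF 3(1)] 3(2) eq hle by (simp add: f_val_def)
  next
    case 4
    obtain r q where rq: "r < y_val V E x" "f_val V E x = (y_val V E x choose 2) + r"
      "m_val V x = (y_val V E x choose 2) + r + 1 + y_val V E x * q" using v_decomp[OF 4(1)] .
    obtain r' q' where rq': "r' < y_val V E x'" "f_val V E x' = (y_val V E x' choose 2) + r'"
      "m_val V x' = (y_val V E x' choose 2) + r' + 1 + y_val V E x' * q'" using v_decomp[OF 4(2)] .
    \<comment> \<open>Uniqueness of the triangular decomposition: equal values force equal
      \<open>y_val\<close> and equal residues.\<close>
    have "(y_val V E x choose 2) < (Suc (y_val V E x') choose 2)"
      "(y_val V E x' choose 2) < (Suc (y_val V E x) choose 2)"
      using eq rq(1,2) rq'(1,2) choose_two_Suc[of "y_val V E x"] choose_two_Suc[of "y_val V E x'"]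
      by linarith+
    then have y: "y_val V E x' = y_val V E x" using less_of_choose_two by (metis less_Suc_eq_le order_antisym)
    then have r: "r' = r" using eq rq(2) rq'(2) by simp
    show ?thesis
    proof (cases "m_val V x' = m_val V x")
      case True
      have "nim_move E (\<lambda>i. x i - m_val V x) (\<lambda>i. x' i - m_val V x)"
        unfolding nim_move_def
      proof (intro bexI[OF _ H(1)] conjI ballI allI impI)
        fix i assume i: "i \<in> H"
        then have "m_val V x \<le> x' i" using m_val_le[of i x'] edge_sub[OF H(1)] True by auto
        then show "x' i - m_val V x < x i - m_val V x" using H(2) i by (simp add: diff_less_mono)
      qed (use H(3) in simp)
      from height_move_less[OF this] show ?thesis using y True by (simp add: y_val_def)
    next
      case False
      \<comment> \<open>The minima agree modulo \<open>y_val\<close>, so the minimum drops by at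
        least \<open>y_val\<close>. A disjoint edge then stays that far above the new minimum and
        makes the new \<open>y_val\<close> too large.\<close>
      have "q' < q"
      proof (rule ccontr)
        assume "\<not> q' < q"
        then have "y_val V E x * q \<le> y_val V E x * q'" by simp
        then show False using False mle rq(3) rq'(3) y r by simp
      qed
      then have "y_val V E x * Suc q' \<le> y_val V E x * q" by (intro mult_le_mono2) simp
      then have m: "m_val V x' + y_val V E x \<le> m_val V x" using rq(3) rq'(3) y r by simp
      from disjoint_edge[OF H(1)] obtain f where f: "f \<in> E" "H \<inter> f = {}" by blast
      have "y_val V E x \<le> height E (\<lambda>i. x' i - m_val V x')"
      proof (rule height_ge_edge[OF f(1)])
        fix i assume "i \<in> f"
        then have "x' i = x i" "i \<in> V" using H(3) f edge_sub by auto
        then show "y_val V E x \<le> x' i - m_val V x'" using m_val_le[of i x] m by simp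
      qed
      then show ?thesis using y by (simp add: y_val_def)
    qed
  qed
qed

text \<open>
  Writing \<open>v = (p choose 2) + r\<close>, the target must have \<open>y = p\<close> and minimum congruent to \<open>v + 1\<close>
  modulo \<open>p\<close>; \<open>s\<close> is the amount by which the minimum has to drop.
\<close>
lemma low_value_move:
  assumes "r < p" "s < p" "m_val V x = (p choose 2) + r + 1 + p * q + s"
    "p \<le> y_val V E x" "s = 0 \<Longrightarrow> p < y_val V E x"
  shows "\<exists>x'. nim_move E x x' \<and> f_val V E x' = (p choose 2) + r"
proof -
  define n where "n = m_val V x - s"
  have n: "m_val V x = n + s" using assms(3) by (simp add: n_def)
  \<comment> \<open>The new minimum is to be \<open>n\<close>, so with \<open>n\<close> removed a
    zero move to height \<open>p - 1\<close> is wanted; \<open>y_val\<close> is one more than that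
    height.\<close>
  define w where "w = (\<lambda>i. x i - n)"
  from m_val_attained obtain j where j: "j \<in> V" "x j = m_val V x" by blast
  have wz: "(\<lambda>i. w i - s) = (\<lambda>i. x i - m_val V x)" by (simp add: w_def n)
  have "\<exists>w'\<in>zero_moves w. height E w' = p - 1"
  \<comment> \<open>For \<open>s = 0\<close> the minimum is kept, so the height must strictly drop;
    for \<open>s > 0\<close> the bound \<open>s < p\<close> makes \<open>p - 1\<close> large enough
    for \<open>zero_move_height\<close>.\<close>
  proof (cases "s = 0")
    case True
    then have "p - 1 < height E w" using assms(1,5) wz by (simp add: y_val_def)
    moreover have w0: "w j = 0" using j n True by (simp add: w_def)
    ultimately obtain w' where w': "nim_move E w w'" "height E w' = p - 1"
      using lower_heights_of_zero[OF j(1)] by blast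
    have "w' j = 0" using w'(1) w0 by (auto simp: nim_move_def) (metis not_less_zero)
    then show ?thesis using w' j(1) by (auto simp: zero_moves_def)
  next
    case False
    show ?thesis
    proof (rule zero_move_height[of s])
      show "s \<le> w i" if "i \<in> V" for i using m_val_le[OF that, of x] n by (simp add: w_def)
      show "p - 1 \<le> height E (\<lambda>i. w i - s)" using assms(4) by (simp add: wz y_val_def)
    qed (use False j n assms(2) in \<open>auto simp: w_def\<close>)
  qed
  then obtain w' where w': "nim_move E w w'" "\<exists>i\<in>V. w' i = 0" "height E w' = p - 1"
    by (auto simp: zero_moves_def)
  from w'(1) obtain H where H: "H \<in> E" "\<forall>i\<in>H. w' i < w i" "\<forall>i. i \<notin> H \<longrightarrow> w' i = w i"
    by (auto simp: nim_move_def)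
  \<comment> \<open>Adding \<open>x i - w i\<close> instead of \<open>n\<close> undoes the truncated
    subtraction also at vertices outside \<open>V\<close>, where \<open>x i\<close> may be below
    \<open>n\<close>.\<close>
  define x' where "x' = (\<lambda>i. w' i + (x i - w i))"
  have wx: "w i \<le> x i" for i by (simp add: w_def)
  have xV: "x' i = w' i + n" if "i \<in> V" for i
    using m_val_le[OF that, of x] n by (simp add: x'_def w_def)
  have "nim_move E x x'"
    unfolding nim_move_def
  proof (intro bexI[OF _ H(1)] conjI ballI allI impI)
    fix i assume "i \<in> H"
    then have "w' i < w i" using H(2) by blast
    then show "x' i < x i" using wx[of i] by (simp add: x'_def)
  next
    fix i assume "i \<notin> H"
    then have "w' i = w i" using H(3) by blast
    then show "x' i = x i" using wx[of i] by (simp add: x'_def)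
  qed
  moreover have "m_val V x' = n" using w'(2) xV by (auto intro: m_val_eqI)
  moreover have "(\<lambda>i. x' i - n) = w'"
  proof
    fix i
    show "x' i - n = w' i"
    proof (cases "i \<in> V")
      case True
      then show ?thesis by (simp add: xV)
    next
      case False
      then have "w' i = w i" using H(1,3) edge_sub by blast
      then show ?thesis by (simp add: x'_def w_def)
    qed
  qed
  ultimately show ?thesis
    using assms(1,3) n w'(3) f_val_eq_v[of x' p r q] y_val_eq[of x' n] by auto
qed

text \<open>The chain starts at a move costing at most one unit of height and ends at a center of
  height at most the minimum. All its members stay in the branch where \<open>f_val\<close> is the
  height.\<close>

lemma high_value_move:
  assumes "0 < m_val V x" "m_val V x \<le> (y_val V E x choose 2)" "m_val V x \<le> v" "v < height E x"
  shows "\<exists>x'. nim_move E x x' \<and> f_val V E x' = v"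
proof -
  let ?M = "{x'. nim_move E x x' \<and> m_val V x' \<le> (y_val V E x' choose 2)}"
  from m_val_attained obtain j where j: "j \<in> V" "x j = m_val V x" by blast
  from optimal_edge_at[OF j(1)] obtain k where k: "{j, k} \<in> E" "j \<noteq> k"
    "height E x \<le> Suc (height E (x(j := x j - 1, k := x k - 1)))" by blast
  have kV: "k \<in> V" using edge_sub[OF k(1)] by simp
  have pos: "0 < x i" if "i \<in> V" for i using m_val_le[OF that, of x] assms(1) by simp
  have zM: "zero_moves x \<subseteq> ?M"
  proof
    fix x' assume "x' \<in> zero_moves x"
    then obtain i where "nim_move E x x'" "i \<in> V" "x' i = 0" by (auto simp: zero_moves_def)
    then show "x' \<in> ?M" using m_val_eqI[of i x' 0] by simp
  qed
  have M: "x(j := a, k := x k - 1) \<in> ?M" if a: "a < x j" for a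
  proof -
    let ?x = "x(j := a, k := x k - 1)"
    have a_le: "a \<le> x i - 1" if "i \<in> V" for i using a j(2) m_val_le[OF that, of x] by simp
    have m: "m_val V ?x = a"
    proof (rule m_val_eqI[OF j(1)])
      show "a \<le> ?x i" if "i \<in> V" for i
        using a_le[OF kV] le_trans[OF a_le[OF that] diff_le_self] by simp
    qed (use k(2) in simp)
    \<comment> \<open>The minimum falls by at least one and \<open>k\<close> only by one, so no
      excess over the minimum shrinks and \<open>y_val\<close> cannot decrease.\<close>
    have "height E (\<lambda>i. x i - m_val V x) \<le> height E (\<lambda>i. ?x i - a)"
      using a j(2) by (intro height_mono) auto
    then have "y_val V E x \<le> y_val V E ?x" using y_val_eq[OF m] by (simp add: y_val_def)
    then have "(y_val V E x choose 2) \<le> (y_val V E ?x choose 2)" by (rule binomial_right_mono)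
    moreover have "nim_move E x ?x" using k(1,2) a pos[OF kV] by (intro edge_move) auto
    ultimately show ?thesis using m a j(2) assms(2) by simp
  qed
  let ?p = "x(j := x j - 1, k := x k - 1)"
  from small_center[OF j(1)] obtain d where d: "d \<in> E" "height E (center d x) \<le> x j" by blast
  have "(?p, center {j, k} x) \<in> (link ?M)\<^sup>*"
    using k(1,2) pos j(1) kV by (intro link_to_center zM M) auto
  also have "(center {j, k} x, center d x) \<in> (link ?M)\<^sup>*"
    using k(1) d(1) pos by (intro link_mono[OF zM] link_centers_connected[OF connected]) auto
  finally have "(?p, center d x) \<in> (link ?M)\<^sup>*" .
  then have "\<exists>x'\<in>?M. height E x' = v"
  proof (rule link_intermediate)
    show "?p \<in> ?M" using pos[OF j(1)] by (intro M) simp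
    show "height E (center d x) \<le> v" using d(2) j(2) assms(3) by simp
    show "v \<le> height E ?p" using k(3) assms(4) by simp
  qed
  then show ?thesis by (auto simp: f_val_def)
qed

lemma f_val_reach:
  assumes v: "v < f_val V E x"
  shows "\<exists>x'. nim_move E x x' \<and> f_val V E x' = v"
proof (cases "m_val V x = 0")
  case True
  from m_val_attained obtain j where j: "j \<in> V" "x j = 0" using True by metis
  from lower_heights_of_zero[of j x v] v f_val_of_zero[of j x] j
  obtain x' where x': "nim_move E x x'" "height E x' = v" by auto
  have "x' j = 0" using x'(1) j(2) by (auto simp: nim_move_def) (metis not_less_zero)
  then show ?thesis using x' f_val_of_zero[OF j(1)] by auto
next
  case False
  let ?y = "y_val V E x"
  from triangular_decomp obtain p r where pr: "r < p" "v = (p choose 2) + r" by blast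
  then have p: "l mod p < p" for l by simp
  consider (high) "m_val V x \<le> (?y choose 2)" "m_val V x \<le> v"
    | (low) "m_val V x \<le> (?y choose 2)" "v < m_val V x"
    | (v) "\<not> m_val V x \<le> (?y choose 2)" by linarith
  then show ?thesis
  proof cases
    case high
    then show ?thesis using False v high_value_move[of x v] by (simp add: f_val_def)
  next
    case low
    \<comment> \<open>The surplus of the minimum over \<open>v + 1\<close>: its quotient by
      \<open>p\<close> becomes \<open>q\<close>, its remainder the required drop
      \<open>s\<close>.\<close>
    define l where "l = m_val V x - v - 1"
    have m: "m_val V x = (p choose 2) + r + 1 + p * (l div p) + l mod p"
      using low(2) pr(2) mult_div_mod_eq[of p l] unfolding l_def by linarith
    have "p choose 2 < (?y choose 2)" using low pr(2) by linarith
    then have "p < ?y" by (rule less_of_choose_two)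
    then show ?thesis using low_value_move[OF pr(1) p m] pr(2) by simp
  next
    case v
    obtain r' q where rq: "r' < ?y" "f_val V E x = (?y choose 2) + r'"
      "m_val V x = (?y choose 2) + r' + 1 + ?y * q" using v_decomp[OF v] .
    define l where "l = m_val V x - v - 1"
    have m: "m_val V x = (p choose 2) + r + 1 + p * (l div p) + l mod p"
      using f_val_less_m_val[OF v] assms pr(2) mult_div_mod_eq[of p l] unfolding l_def by linarith
    have "p choose 2 < (Suc ?y choose 2)" using assms rq pr(2) choose_two_Suc[of ?y] by linarith
    then have "p < Suc ?y" by (rule less_of_choose_two)
    \<comment> \<open>With no drop and \<open>p = ?y\<close>, the position \<open>x\<close> itself
      would have value \<open>v\<close>.\<close>
    moreover have "p \<noteq> ?y" if "l mod p = 0"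
    proof
      assume "p = ?y"
      with m that pr(1) have "f_val V E x = (p choose 2) + r" by (intro f_val_eq_v[of _ _ _ "l div p"]) auto
      then show False using assms pr(2) by simp
    qed
    ultimately have "p \<le> ?y" "l mod p = 0 \<Longrightarrow> p < ?y" by linarith+
    from low_value_move[OF pr(1) p m this] show ?thesis using pr(2) by simp
  qed
qed

text \<open>\<open>f_val\<close> satisfies the mex recursion: no move preserves it, and moves reach
  every smaller value.\<close>

lemma JM: "JM V E"
  unfolding JM_def
proof
  fix x :: "'a \<Rightarrow> nat"
  show "grundy E x = f_val V E x"
    using wf_nim_move[OF hyp]
  proof (induction x rule: wf_induct_rule)
    case (less x)
    have "mex {grundy E x' | x'. nim_move E x x'} = f_val V E x"
      unfolding mex_def
    proof (rule Least_equality)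
      show "f_val V E x \<notin> {grundy E x' | x'. nim_move E x x'}"
        using less f_val_move_neq by fastforce
      show "f_val V E x \<le> n" if "n \<notin> {grundy E x' | x'. nim_move E x x'}" for n
      proof (rule ccontr)
        assume "\<not> f_val V E x \<le> n"
        then obtain x' where "nim_move E x x'" "f_val V E x' = n" using f_val_reach[of n x] by auto
        then have "n \<in> {grundy E x' | x'. nim_move E x x'}"
          using less[of x'] by (intro CollectI exI[of _ x']) simp
        with that show False by contradiction
      qed
    qed
    then show ?case by (subst grundy_rec[OF hyp])
  qed
qed

end

section \<open>Necessity\<close>

locale nim_graph_JM = nim_graph +
  assumes JM: "JM V E"
begin

lemma grundy_f: "x \<in> positions V \<Longrightarrow> grundy E x = f_val V E x"
  using JM by (simp add: JM_def)

lemma value_move: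
  assumes "x \<in> positions V" "n < f_val V E x"
  shows "\<exists>x'. nim_move E x x' \<and> f_val V E x' = n"
proof -
  have "n < (LEAST k. k \<notin> {grundy E x' | x'. nim_move E x x'})"
    using assms grundy_f grundy_rec[OF hyp, of x] by (simp add: mex_def)
  then have "n \<in> {grundy E x' | x'. nim_move E x x'}" using not_less_Least by blast
  then obtain x' where "nim_move E x x'" "grundy E x' = n" by blast
  then show ?thesis using grundy_f nim_move_positions[OF hyp assms(1)] by auto
qed

lemma transversal_free: "transversal_free E"
  unfolding transversal_free_def
proof (rule ccontr)
  assume "\<not> (\<forall>H\<in>E. \<exists>H'\<in>E. H \<inter> H' = {})"
  then obtain e where e: "e \<in> E" "\<And>f. f \<in> E \<Longrightarrow> e \<inter> f \<noteq> {}" by blast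
  define x where "x i = (if i \<in> V then 1 else 0 :: nat)" for i
  have x: "x \<in> positions V" by (simp add: positions_def x_def)
  obtain j where j: "j \<in> V" using V_nonempty by blast
  have m: "m_val V x = 1" using j by (intro m_val_eqI) (auto simp: x_def)
  have "y_val V E x = 1"
    \<comment> \<open>Thus the minimum 1 exceeds \<open>1 choose 2 = 0\<close>, and the residue
      modulo 1 vanishes.\<close>
    using height_eq_0[of "\<lambda>i. x i - 1"] edge_nonempty by (simp add: y_val_eq[OF m] x_def) blast
  then have f0: "f_val V E x = 0" using f_val_eq_v[of x 1 0 0] m by simp
  have move: "nim_move E x (center e x)"
    unfolding nim_move_def using e(1) edge_sub[OF e(1)]
    by (intro bexI[of _ e]) (auto simp: center_def x_def)
  have "height E (center e x) = 0" using e(2) by (intro height_eq_0) (auto simp: center_def)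
  moreover obtain i where "i \<in> e" using edge_nonempty[OF e(1)] by blast
  ultimately have "f_val V E (center e x) = 0"
    using f_val_of_zero[of i "center e x"] edge_sub[OF e(1)] by (auto simp: center_def)
  then have mem: "0 \<in> {grundy E x' | x'. nim_move E x x'}"
    using move grundy_f[OF nim_move_positions[OF hyp x move]] by force
  \<comment> \<open>Finiteness ensures that \<open>LEAST\<close> in \<open>mex\<close> really picks
    a missing value. From the all-ones vector a move can only empty its edge.\<close>
  have "{grundy E x' | x'. nim_move E x x'} \<subseteq> (\<lambda>f. grundy E (center f x)) ` E"
  proof
    fix n assume "n \<in> {grundy E x' | x'. nim_move E x x'}"
    then obtain x' H where n: "n = grundy E x'" and H: "H \<in> E" "\<forall>i\<in>H. x' i < x i" "\<forall>i. i \<notin> H \<longrightarrow> x' i = x i"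
      by (auto simp: nim_move_def)
    have "x' i = center H x i" for i
      using H(2,3) by (cases "i \<in> H") (force simp: center_def x_def split: if_splits)+
    then have "x' = center H x" by blast
    then show "n \<in> (\<lambda>f. grundy E (center f x)) ` E" using n H(1) by blast
  qed
  moreover have "finite E" using fin edge_sub by (meson PowI finite_Pow_iff finite_subset subsetI)
  ultimately have "finite {grundy E x' | x'. nim_move E x x'}" using finite_surj by blast
  then have "\<exists>n. n \<notin> {grundy E x' | x'. nim_move E x x'}" using ex_new_if_finite[OF infinite_UNIV_nat] by blast
  then have "mex {grundy E x' | x'. nim_move E x x'} \<notin> {grundy E x' | x'. nim_move E x x'}"
    unfolding mex_def by (rule LeastI_ex)
  moreover have "mex {grundy E x' | x'. nim_move E x x'} = 0"
    using grundy_rec[OF hyp, of x] grundy_f[OF x] f0 by metis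
  ultimately show False using mem by metis
qed

text \<open>The indicator of \<open>S\<close> has a zero entry and positive height, so some move
  leads to height 0; its edge lies in \<open>S\<close> and meets every edge inside
  \<open>S\<close>.\<close>

lemma minimal_transversal_free: "minimal_transversal_free V E"
  unfolding minimal_transversal_free_def
proof (intro conjI allI impI transversal_free)
  fix S assume S: "S \<subset> V \<and> induced E S \<noteq> {}"
  define x where "x i = (if i \<in> S then 1 else 0 :: nat)" for i
  have x: "x \<in> positions V" using S by (auto simp: positions_def x_def)
  obtain j where j: "j \<in> V" "j \<notin> S" using S by blast
  obtain f where f: "f \<in> E" "f \<subseteq> S" using S by (auto simp: induced_def)
  then have "1 \<le> height E x" by (intro height_ge_edge[of f]) (auto simp: x_def)
  then have "0 < f_val V E x" using f_val_of_zero[OF j(1), of x] j(2) by (simp add: x_def)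
  from value_move[OF x this] obtain x' where x': "nim_move E x x'" "f_val V E x' = 0" by blast
  from x'(1) obtain H where H: "H \<in> E" "\<forall>i\<in>H. x' i < x i" "\<forall>i. i \<notin> H \<longrightarrow> x' i = x i"
    by (auto simp: nim_move_def)
  have HS: "H \<subseteq> S"
  proof
    fix i assume "i \<in> H"
    then have "0 < x i" using H(2) by (metis gr_zeroI not_less_zero)
    then show "i \<in> S" by (simp add: x_def split: if_splits)
  qed
  then have "x' j = 0" using H(3) j(2) by (auto simp: x_def)
  then have h: "height E x' = 0" using x'(2) f_val_of_zero[OF j(1)] by metis
  have "H \<inter> g \<noteq> {}" if g: "g \<in> induced E S" for g
  proof
    assume "H \<inter> g = {}"
    then have "x' i = 1" if "i \<in> g" for i
    proof -
      have "i \<notin> H" "i \<in> S" using \<open>H \<inter> g = {}\<close> g that by (auto simp: induced_def)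
      then show ?thesis using H(3) by (simp add: x_def)
    qed
    then have "1 \<le> height E x'"
      using g by (intro height_ge_edge[of g]) (auto simp: induced_def)
    then show False using h by simp
  qed
  then show "\<exists>H\<in>induced E S. \<forall>H'\<in>induced E S. H \<inter> H' \<noteq> {}"
    using H(1) HS by (intro bexI[of _ H]) (auto simp: induced_def)
qed

lemma not_two_edges:
  assumes "E = {e, f}" "e \<inter> f = {}"
  shows False
proof -
  have V: "V = e \<union> f" using hyp assms(1) by (auto simp: hypergraph_def)
  have ef: "e \<in> E" "f \<in> E" using assms(1) by auto
  then obtain a c where ac: "a \<in> e" "c \<in> f" using edge_nonempty by blast
  have aV: "a \<in> V" "c \<in> V" using V ac by auto
  define x where "x i = (if i \<in> e then 3 else if i \<in> f then 1 else 0 :: nat)" for i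
  have x: "x \<in> positions V" using V by (auto simp: positions_def x_def)
  have fx: "x i = 1" if "i \<in> f" for i using that assms(2) by (auto simp: x_def)
  have m: "m_val V x = 1" using aV(2) fx[OF ac(2)] V by (intro m_val_eqI) (auto simp: x_def)
  have "1 \<le> height E (\<lambda>i. x i - 1)" using ef(1) by (intro height_ge_edge[of e]) (auto simp: x_def)
  \<comment> \<open>Since \<open>2 choose 2 = 1\<close>, a \<open>y_val\<close> of at least 2 puts
    minimum 1 into the height branch.\<close>
  then have "2 choose 2 \<le> (y_val V E x choose 2)" by (intro binomial_right_mono) (simp add: y_val_eq[OF m])
  then have "f_val V E x = height E x" using m by (simp add: f_val_def)
  moreover have "3 \<le> height E x" using ef(1) by (intro height_ge_edge[of e]) (auto simp: x_def)
  ultimately have "2 < f_val V E x" by simp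
  from value_move[OF x this] obtain x' where x': "nim_move E x x'" "f_val V E x' = 2" by blast
  from x'(1) obtain H where H: "H \<in> E" "\<forall>i\<in>H. x' i < x i" "\<forall>i. i \<notin> H \<longrightarrow> x' i = x i"
    by (auto simp: nim_move_def)
  from H(1) assms(1) consider "H = f" | "H = e" by blast
  then show False
  proof cases
    case 1
    have "x' c = 0" using H(2) fx[OF ac(2)] ac(2) 1 by auto
    then have "height E x' = 2" using f_val_of_zero[OF aV(2)] x'(2) by metis
    moreover have "3 \<le> height E x'"
      using ef(1) H(3) 1 assms(2) by (intro height_ge_edge[of e]) (auto simp: x_def)
    ultimately show False by simp
  next
    case 2
    have e2: "x' i \<le> 2" if "i \<in> e" for i using H(2) that 2 by (force simp: x_def)
    have f1: "x' i = 1" if "i \<in> f" for i using H(3) fx[OF that] that 2 assms(2) by auto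
    \<comment> \<open>Playing \<open>e\<close> yields value at most 1 if it empties a vertex, value
      0 if its minimum becomes 1, and height at least 3 if both entries become 2.\<close>
    consider (0) i where "i \<in> e" "x' i = 0" | (1) i where "i \<in> e" "x' i = 1" "\<forall>i\<in>e. 1 \<le> x' i"
      | (2) "\<forall>i\<in>e. x' i = 2"
    proof -
      have "(\<exists>i\<in>e. x' i = 0) \<or> (\<exists>i\<in>e. x' i = 1) \<and> (\<forall>i\<in>e. 1 \<le> x' i) \<or> (\<forall>i\<in>e. x' i = 2)"
        using e2 by (metis One_nat_def Suc_1 le_0_eq le_SucE not_less_eq_eq)
      then show thesis using that by blast
    qed
    then show False
    proof cases
      case 0
      have "height E x' \<le> x' c"
      proof (rule height_le_vertex)
        fix g assume g: "g \<in> E" "\<And>i. i \<in> g \<Longrightarrow> 0 < x' i"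
        have "g \<noteq> e" using g(2)[of i] 0 by auto
        then show "c \<in> g" using g(1) ac(2) assms(1) by blast
      qed
      then show False using f1[OF ac(2)] f_val_of_zero[of i x'] 0 V x'(2) by auto
    next
      case 1
      have m: "m_val V x' = 1" using 1 V f1 by (intro m_val_eqI[of i]) auto
      have "height E (\<lambda>i. x' i - 1) = 0"
        using 1(1,2) ac(2) f1 assms(1) by (intro height_eq_0) (auto intro: bexI[of _ i] bexI[of _ c])
      then have "f_val V E x' = 0" using f_val_eq_v[of x' 1 0 0] m y_val_eq[OF m] by simp
      then show False using x'(2) by simp
    next
      case 2
      have m: "m_val V x' = 1" using f1[OF ac(2)] aV(2) V 2 f1 by (intro m_val_eqI[of c]) auto
      have "1 \<le> height E (\<lambda>i. x' i - 1)" using ef(1) 2 by (intro height_ge_edge[of e]) auto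
      then have "2 choose 2 \<le> (y_val V E x' choose 2)"
        by (intro binomial_right_mono) (simp add: y_val_eq[OF m])
      then have "f_val V E x' = height E x'" using m by (simp add: f_val_def)
      moreover have "packing E x' [e, e, f]"
        using assms ef 2 f1 by (auto simp: packing_def)
      ultimately show False using length_packing_le[of x' "[e, e, f]"] x'(2) by simp
    qed
  qed
qed

text \<open>Edges \<open>e\<close> and \<open>f\<close> in different components leave no edge
  meeting both, so minimality forces \<open>V = e \<union> f\<close>; as edges have two vertices,
  only \<open>e\<close> and \<open>f\<close> remain.\<close>

lemma graph_connected: "graph_connected V E"
  unfolding graph_connected_def
proof (intro ballI, rule ccontr)
  fix u w assume uw: "u \<in> V" "w \<in> V" and not: "(u, w) \<notin> {(a, b). {a, b} \<in> E}\<^sup>*"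
  define C where "C = {v. (u, v) \<in> {(a, b). {a, b} \<in> E}\<^sup>*}"
  have C: "g \<subseteq> C" if g: "g \<in> E" "i \<in> g" "i \<in> C" for g i
  proof -
    from other_end[OF g(1,2)] obtain k where k: "g = {i, k}" by blast
    then have "(i, k) \<in> {(a, b). {a, b} \<in> E}" using g(1) by simp
    then have "k \<in> C" using g(3) unfolding C_def by (auto intro: rtrancl_into_rtrancl)
    then show ?thesis using k g(3) by simp
  qed
  from covered uw obtain e f where ef: "e \<in> E" "u \<in> e" "f \<in> E" "w \<in> f" by blast
  have eC: "e \<subseteq> C" using C[OF ef(1,2)] by (simp add: C_def)
  have fC: "f \<inter> C = {}" using C[OF ef(3)] ef(4) not by (auto simp: C_def)
  have split: "g \<inter> f = {} \<or> g \<inter> e = {}" if "g \<in> E" for g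
    using C[OF that] eC fC by blast
  have V: "e \<union> f = V"
  proof (rule ccontr)
    assume "e \<union> f \<noteq> V"
    then have "e \<union> f \<subset> V" using edge_sub ef by blast
    moreover have mem: "e \<in> induced E (e \<union> f)" "f \<in> induced E (e \<union> f)"
      using ef by (auto simp: induced_def)
    ultimately obtain d where d: "d \<in> induced E (e \<union> f)" "\<forall>g\<in>induced E (e \<union> f). d \<inter> g \<noteq> {}"
      using minimal_transversal_free unfolding minimal_transversal_free_def by (metis empty_iff)
    then have "d \<in> E" by (simp add: induced_def)
    from split[OF this] d(2) mem show False by blast
  qed
  have "g = e \<or> g = f" if g: "g \<in> E" for g
  proof -
    have "g \<subseteq> e \<or> g \<subseteq> f" using split[OF g] edge_sub[OF g] V by blast
    then show ?thesis
      using card_subset_eq[of e g] card_subset_eq[of f g] card2 g ef fin edge_sub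
      by (metis finite_subset)
  qed
  then have "E = {e, f}" using ef by blast
  then show False using not_two_edges eC fC by blast
qed

end

theorem theorem5p12:
  fixes V :: "'a set" and E :: "'a set set"
  assumes "simple_graph V E"
    and "no_isolated_vertices V E"
  shows "JM V E \<longleftrightarrow> graph_connected V E \<and> minimal_transversal_free V E"
proof -
  interpret nim_graph V E
    using simple_graph_hypergraph[OF assms] assms(1) by unfold_locales (auto simp: simple_graph_def)
  show ?thesis
  proof
    assume "JM V E"
    then interpret nim_graph_JM V E by unfold_locales
    show "graph_connected V E \<and> minimal_transversal_free V E"
      using graph_connected minimal_transversal_free ..
  next
    assume "graph_connected V E \<and> minimal_transversal_free V E"
    then interpret nim_graph_mtf V E by unfold_locales auto
    show "JM V E" by (rule JM)
  qed
qed

end
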